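(* Let $g(x)=\sum_{n\ge 0} g_n x^n$ be a formal power series over $\mathbb{R}$ or $\mathbb{C}$ with $g_0\neq 0$ and $g(x)\neq -1$, and suppose the Riordan array $(1,xg(x))$ is a pseudo-involution, i.e. $$(1,xg(x))^{-1}=(1,xg(-x))=M(1,xg(x))M,\qquad M=(1,-x).$$ Then $(1,xg(x))$ can be represented in the form $$(1,xg(x))=\left(1,x\sqrt{g(x)}\right)(1,xh(x)),$$ where $h$ is a power series satisfying $h(-x)=h^{-1}(x)$ and $h(x)=s(x)+\sqrt{s^2(x)+1}$ for a power series $s(x)=\sum_n s_nx^n$ with $s_{2n}=0$ for all $n\ge 0$.
   Context: For formal power series $f(x)$ and $\phi(x)$ with $\phi_0=0$, the Riordan array $(f(x),\phi(x))$ is the infinite lower-triangular matrix whose $n$th column ($n=0,1,2,\dots$) has generating function $f(x)\phi^n(x)$; it acts on power series by $(f(x),\phi(x))a(x)=f(x)a(\phi(x))$, and products satisfy $(f(x),\phi(x))(b(x),\psi(x))=(f(x)b(\phi(x)),\psi(\phi(x)))$. Arrays $(f(x),xg(x))$ with $f_0\ne0$, $g_0\ne0$ form a group (the Riordan group); $(1,xg(x))$ is the composition operator $a(x)\mapsto a(xg(x))$. $M=(1,-x)$ is the diagonal matrix $\mathrm{diag}(1,-1,1,-1,\dots)$. A Riordan array $R$ is a pseudo-involution if $R^{-1}=MRM$. Here $h^{-1}(x)$ denotes the multiplicative inverse $1/h(x)$, and square roots of power series with constant term $1$ denote the power series square root with constant term $1$. *)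

theory Defs
  imports Complex_Main "HOL-Computational_Algebra.Formal_Power_Series"
begin

text \<open>
  Infinite matrices are functions \<open>A\<close> with \<open>A i j\<close> the entry in row \<open>i\<close> and column \<open>j\<close>,
  both counted from 0.
\<close>

type_synonym 'a infmat = "nat \<Rightarrow> nat \<Rightarrow> 'a"

definition lower_triangular :: "'a::zero infmat \<Rightarrow> bool" where
  "lower_triangular A \<longleftrightarrow> (\<forall>i j. i < j \<longrightarrow> A i j = 0)"

text \<open>
  If the left factor is lower triangular, the terms with \<open>k > i\<close> of the matrix product vanish,
  so the finite sum below is the whole product.
\<close>

definition tri_mult :: "'a::comm_semiring_1 infmat \<Rightarrow> 'a infmat \<Rightarrow> 'a infmat"
    (infixl "\<odot>" 70) where
  "A \<odot> B = (\<lambda>i j. \<Sum>k\<le>i. A i k * B k j)"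

definition tri_one :: "'a::comm_semiring_1 infmat" where
  "tri_one = (\<lambda>i j. if i = j then 1 else 0)"

definition is_tri_inverse :: "'a::comm_semiring_1 infmat \<Rightarrow> 'a infmat \<Rightarrow> bool" where
  "is_tri_inverse A B \<longleftrightarrow> lower_triangular A \<and> lower_triangular B \<and>
     A \<odot> B = tri_one \<and> B \<odot> A = tri_one"

text \<open>
  The matrix \<open>riordan f \<phi>\<close> is meant for \<open>fps_nth \<phi> 0 = 0\<close>, where it is lower triangular.
\<close>

definition riordan :: "'a::comm_ring_1 fps \<Rightarrow> 'a fps \<Rightarrow> 'a infmat" where
  "riordan f \<phi> = (\<lambda>i j. fps_nth (f * \<phi> ^ j) i)"

definition riordan_M :: "'a::comm_ring_1 infmat" where
  "riordan_M = riordan 1 (- fps_X)"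

definition pseudo_involution :: "'a::comm_ring_1 infmat \<Rightarrow> bool" where
  "pseudo_involution R \<longleftrightarrow> is_tri_inverse R (riordan_M \<odot> R \<odot> riordan_M)"

text \<open>
  Only meaningful for series with constant term 1, where existence and uniqueness hold by
  \<open>fps_sqrt_unique\<close> below.
\<close>

definition fps_sqrt :: "'a::field_char_0 fps \<Rightarrow> 'a fps" where
  "fps_sqrt f = (THE q. fps_nth q 0 = 1 \<and> q ^ 2 = f)"

lemma fps_sqrt_unique:
  fixes f :: "'a::field_char_0 fps"
  assumes "fps_nth f 0 = 1"
  shows "\<exists>!q. fps_nth q 0 = 1 \<and> q ^ 2 = f"
proof (rule ex_ex1I)
  let ?q = "fps_radical (\<lambda>_ _. 1) (Suc 1) f"
  have "?q ^ Suc 1 = f"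
    using power_radical[of f "\<lambda>_ _. 1" 1] assms by simp
  moreover have "fps_nth ?q 0 = 1" by simp
  ultimately show "\<exists>q. fps_nth q 0 = 1 \<and> q ^ 2 = f"
    by (metis Suc_1)
next
  fix p q assume p: "fps_nth p 0 = 1 \<and> p ^ 2 = f" and q: "fps_nth q 0 = 1 \<and> q ^ 2 = f"
  then have "p = q \<or> p = - q" by (metis power2_eq_iff)
  moreover have "p \<noteq> - q"
  proof
    assume "p = - q"
    then have "fps_nth p 0 = - fps_nth q 0" by simp
    with p q show False by simp
  qed
  ultimately show "p = q" by blast
qed

lemma fps_sqrt:
  assumes "fps_nth f 0 = 1"
  shows "fps_nth (fps_sqrt f) 0 = 1" and "fps_sqrt f ^ 2 = f"
  using theI'[OF fps_sqrt_unique[OF assms]] by (simp_all add: fps_sqrt_def)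

lemma lower_triangular_riordan:
  assumes "fps_nth \<phi> 0 = 0"
  shows "lower_triangular (riordan f \<phi>)"
  unfolding lower_triangular_def riordan_def fps_mult_nth
  using startsby_zero_power_prefix[OF assms] by (auto intro!: sum.neutral)

lemma riordan_apply:
  assumes "fps_nth \<phi> 0 = 0"
  shows "(\<Sum>k\<le>i. riordan f \<phi> i k * fps_nth a k) = fps_nth (f * fps_compose a \<phi>) i"
proof -
  have "fps_nth (f * fps_compose a \<phi>) i
      = (\<Sum>m=0..i. fps_nth f m * (\<Sum>k=0..i-m. fps_nth a k * fps_nth (\<phi> ^ k) (i - m)))"
    by (simp add: fps_mult_nth fps_compose_nth)
  also have "\<dots> = (\<Sum>m=0..i. fps_nth f m * (\<Sum>k=0..i. fps_nth a k * fps_nth (\<phi> ^ k) (i - m)))"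
    using startsby_zero_power_prefix[OF assms]
    by (intro sum.cong refl arg_cong2[where f = "(*)"] sum.mono_neutral_left) auto
  also have "\<dots> = (\<Sum>k=0..i. \<Sum>m=0..i. fps_nth f m * (fps_nth a k * fps_nth (\<phi> ^ k) (i - m)))"
    by (simp only: sum_distrib_left) (rule sum.swap)
  also have "\<dots> = (\<Sum>k\<le>i. riordan f \<phi> i k * fps_nth a k)"
    by (simp add: riordan_def fps_mult_nth sum_distrib_left atLeast0AtMost mult_ac)
  finally show ?thesis by simp
qed

lemma riordan_mult:
  fixes f \<phi> b \<psi> :: "'a::idom fps"
  assumes "fps_nth \<phi> 0 = 0"
  shows "riordan f \<phi> \<odot> riordan b \<psi> = riordan (f * fps_compose b \<phi>) (fps_compose \<psi> \<phi>)"
proof (intro ext)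
  fix i j
  have "(riordan f \<phi> \<odot> riordan b \<psi>) i j = fps_nth (f * fps_compose (b * \<psi> ^ j) \<phi>) i"
    using riordan_apply[OF assms, of f i "b * \<psi> ^ j"] by (simp add: tri_mult_def riordan_def[of b])
  then show "(riordan f \<phi> \<odot> riordan b \<psi>) i j
      = riordan (f * fps_compose b \<phi>) (fps_compose \<psi> \<phi>) i j"
    by (simp add: riordan_def fps_compose_mult_distrib[OF assms] fps_compose_power[OF assms] mult.assoc)
qed

lemma riordan_M_conj:
  fixes g :: "'a::idom fps"
  shows "riordan_M \<odot> riordan 1 (fps_X * g) \<odot> riordan_M
    = riordan 1 (fps_X * fps_compose g (- fps_X))"
  by (simp add: riordan_M_def riordan_mult fps_compose_mult_distrib fps_compose_uminus)

end

theory Submission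
  imports Defs
begin

text \<open>
  Write \<open>\<phi> = x g(x)\<close>. Pseudo-involutivity says that \<open>-\<phi>\<close> is an involution under composition,
  equivalently that \<open>g(-\<phi>) = 1/g\<close>, and an involution tangent to the identity is
  the identity; hence \<open>g\<^sub>0 = 1\<close> unless \<open>g = -1\<close>. Put \<open>\<sigma> = \<surd>g\<close> and \<open>u = x \<sigma>(x)\<close>. The desired
  factorisation means \<open>h(u) = \<sigma>\<close>, which determines \<open>h\<close>. Since \<open>\<sigma>(-\<phi>) = 1/\<sigma>\<close>, we get
  \<open>u(-\<phi>) = -u\<close> and thus \<open>h(-u) = \<sigma>(-\<phi>) = 1/h(u)\<close>. Finally \<open>s = (h - 1/h)/2\<close> is odd and
  \<open>s\<^sup>2 + 1 = ((h + 1/h)/2)\<^sup>2\<close>.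
\<close>

lemma fps_sqrt_eqI:
  fixes q :: "'a::field_char_0 fps"
  assumes "fps_nth q 0 = 1" "q ^ 2 = f"
  shows "fps_sqrt f = q"
proof -
  have "fps_nth f 0 = 1"
    using assms by (auto simp: power2_eq_square)
  then show ?thesis
    using fps_sqrt_unique[of f] fps_sqrt[of f] assms by blast
qed

lemma fps_compose_involution_tangent_id:
  fixes f :: "'a::field_char_0 fps"
  assumes "fps_nth f 0 = 0" "fps_nth f 1 = 1" and inv: "fps_compose f f = fps_X"
  shows "f = fps_X"
proof (rule ccontr)
  \<comment> \<open>The difference \<open>f - x\<close> is negated by composition with \<open>f\<close>, which preserves its lowest term.\<close>
  assume "f \<noteq> fps_X"
  define d where "d = f - fps_X"
  define m where "m = subdegree d"
  have "d \<noteq> 0"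
    using \<open>f \<noteq> fps_X\<close> by (simp add: d_def)
  then have dm: "fps_nth d m \<noteq> 0"
    by (simp add: m_def)
  have low: "fps_nth d i = 0" if "i < m" for i
    using that unfolding m_def by (rule nth_less_subdegree_zero)
  have "fps_compose d f = - d"
    using inv assms(1) by (simp add: d_def fps_compose_sub_distrib)
  moreover have "fps_nth (fps_compose d f) m = (\<Sum>i\<in>{m}. fps_nth d i * fps_nth (f ^ i) m)"
    unfolding fps_compose_nth
    using low by (intro sum.mono_neutral_right) simp_all
  moreover have "fps_nth (f ^ m) m = 1"
    using startsby_zero_power_nth_same[OF assms(1), of m] assms(2) by simp
  ultimately have "fps_nth d m = - fps_nth d m"
    by simp
  with dm show False
    by simp
qed

text \<open>Column 1 of \<open>riordan 1 \<psi>\<close> lists the coefficients of \<psi>, so column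
  1 of R times MRM = I is an identity of power series; cancelling \<open>fps_X\<close> in it leaves
  the claim.\<close>

lemma pseudo_involution_compose:
  fixes g :: "'a::idom fps"
  assumes "pseudo_involution (riordan 1 (fps_X * g))"
  shows "fps_compose g (- (fps_X * g)) * g = 1"
proof -
  let ?\<phi> = "fps_X * g"
  have "riordan 1 (fps_compose (fps_X * fps_compose g (- fps_X)) ?\<phi>) = tri_one"
    using assms
    by (simp add: pseudo_involution_def is_tri_inverse_def riordan_M_conj riordan_mult)
  then have "riordan 1 (fps_compose (fps_X * fps_compose g (- fps_X)) ?\<phi>) i 1 = tri_one i 1" for i
    by simp
  then have "fps_nth (fps_compose (fps_X * fps_compose g (- fps_X)) ?\<phi>) i = fps_nth fps_X i" for i
    by (simp add: riordan_def tri_one_def)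
  then have "fps_compose (fps_X * fps_compose g (- fps_X)) ?\<phi> = fps_X"
    by (simp add: fps_eq_iff)
  moreover have "fps_compose (fps_compose g (- fps_X)) ?\<phi> = fps_compose g (- ?\<phi>)"
    by (subst fps_compose_assoc[symmetric]) (simp_all add: fps_compose_uminus)
  ultimately have "fps_X * (fps_compose g (- ?\<phi>) * g) = fps_X * 1"
    by (simp add: fps_compose_mult_distrib mult_ac)
  then show ?thesis
    by (rule mult_left_cancel[OF fps_X_neq_zero, THEN iffD1])
qed

lemma pseudo_involution_nth_0:
  fixes g :: "'a::field_char_0 fps"
  assumes "pseudo_involution (riordan 1 (fps_X * g))" "g \<noteq> - 1"
  shows "fps_nth g 0 = 1"
proof -
  let ?\<phi> = "fps_X * g"
  note comp = pseudo_involution_compose[OF assms(1)]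
  have "fps_nth (fps_compose g (- ?\<phi>) * g) 0 = fps_nth g 0 * fps_nth g 0"
    by simp
  then have "fps_nth g 0 * fps_nth g 0 = 1"
    by (simp add: comp)
  then have "fps_nth g 0 = 1 \<or> fps_nth g 0 = - 1"
    by (simp add: square_eq_1_iff)
  moreover have "g = - 1" if "fps_nth g 0 = - 1"
  proof -
    have "fps_compose (- ?\<phi>) (- ?\<phi>) = fps_X * (fps_compose g (- ?\<phi>) * g)"
      by (simp add: fps_compose_uminus fps_compose_mult_distrib mult_ac)
    then have "fps_compose (- ?\<phi>) (- ?\<phi>) = fps_X"
      by (simp add: comp)
    \<comment> \<open>The linear coefficient of \<open>- ?\<phi>\<close> is
      \<open>- fps_nth g 0\<close>, which is 1 in this case.\<close>
    then have "- ?\<phi> = fps_X"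
      by (rule fps_compose_involution_tangent_id[rotated 2]) (simp_all add: that)
    then have "fps_X * (- g) = fps_X * 1"
      by simp
    then have "- g = 1"
      by (rule mult_left_cancel[OF fps_X_neq_zero, THEN iffD1])
    then show ?thesis
      by (metis minus_minus)
  qed
  ultimately show ?thesis
    using assms(2) by blast
qed

lemma fps_inv_nth_0: "fps_nth (fps_inv u) 0 = 0"
  by (simp add: fps_inv_def)

text \<open>Composing with the compositional inverse \<open>fps_inv u\<close> undoes composition
  with \<open>u\<close>.\<close>

lemma fps_compose_right_cancel:
  fixes a b u :: "'a::field fps"
  assumes "fps_nth u 0 = 0" "fps_nth u 1 \<noteq> 0" "fps_compose a u = fps_compose b u"
  shows "a = b"
proof -
  have "fps_compose (fps_compose c u) (fps_inv u) = c" for c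
    by (subst fps_compose_assoc[symmetric])
      (simp_all add: fps_inv_right[OF assms(1,2)] assms(1) fps_inv_nth_0)
  then show ?thesis
    using assms(3) by metis
qed

lemma fps_reciprocal_symmetric_representation:
  fixes h :: "'a::field_char_0 fps"
  assumes h0: "fps_nth h 0 = 1" and sym: "fps_compose h (- fps_X) = inverse h"
  obtains s where "h = s + fps_sqrt (s ^ 2 + 1)" "\<And>n. fps_nth s (2 * n) = 0"
proof
  define c :: "'a fps" where "c = fps_const (1 / 2)"
  define s where "s = c * (h - inverse h)"
  define q where "q = c * (h + inverse h)"
  have c: "c + c = 1"
    unfolding c_def fps_const_add by simp
  have hi: "h * inverse h = 1"
    using h0 by (simp add: inverse_mult_eq_1')
  have "fps_nth q 0 = 1"
    using h0 by (simp add: q_def c_def)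
  moreover have "q ^ 2 = s ^ 2 + 1"
  proof -
    \<comment> \<open>Difference of squares. Writing 1 as \<open>c + c\<close> makes this a pure
      ring identity.\<close>
    have "q ^ 2 = s ^ 2 + (c + c) * (c + c) * (h * inverse h)"
      by (simp add: q_def s_def power2_eq_square algebra_simps)
    then show ?thesis
      by (simp add: c hi)
  qed
  ultimately have "fps_sqrt (s ^ 2 + 1) = q"
    by (rule fps_sqrt_eqI)
  moreover have "s + q = (c + c) * h"
    by (simp add: s_def q_def algebra_simps)
  ultimately show "h = s + fps_sqrt (s ^ 2 + 1)"
    by (simp add: c)
  show "fps_nth s (2 * n) = 0" for n
  proof -
    \<comment> \<open>Substituting -x changes only the signs of odd coefficients.\<close>
    have "fps_nth (inverse h) (2 * n) = fps_nth h (2 * n)"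
      by (simp flip: sym add: fps_compose_uminus')
    then show ?thesis
      by (simp add: s_def c_def)
  qed
qed

theorem theorem1:
  fixes g :: "'a::real_normed_field fps"
  assumes "fps_nth g 0 \<noteq> 0"
    and "g \<noteq> - 1"
    and "pseudo_involution (riordan 1 (fps_X * g))"
  shows "\<exists>h s. riordan 1 (fps_X * g) = riordan 1 (fps_X * fps_sqrt g) \<odot> riordan 1 (fps_X * h)
    \<and> fps_compose h (- fps_X) = inverse h
    \<and> h = s + fps_sqrt (s ^ 2 + 1)
    \<and> (\<forall>n. fps_nth s (2 * n) = 0)"
proof -
  define \<phi> where "\<phi> = fps_X * g"
  define \<sigma> where "\<sigma> = fps_sqrt g"
  define u where "u = fps_X * \<sigma>"
  define h where "h = fps_compose \<sigma> (fps_inv u)"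
  have g0: "fps_nth g 0 = 1"
    using assms(2,3) by (rule pseudo_involution_nth_0[rotated])
  then have \<sigma>0: "fps_nth \<sigma> 0 = 1" and \<sigma>2: "\<sigma> * \<sigma> = g"
    using fps_sqrt[of g] by (simp_all add: \<sigma>_def power2_eq_square)
  have \<phi>0: "fps_nth \<phi> 0 = 0" and u0: "fps_nth u 0 = 0" and u1: "fps_nth u 1 \<noteq> 0"
    by (simp_all add: \<phi>_def u_def \<sigma>0)
  have hu: "fps_compose h u = \<sigma>"
    unfolding h_def
    by (subst fps_compose_assoc[symmetric]) (simp_all add: u0 fps_inv[OF u0 u1] fps_inv_nth_0)
  have h0: "fps_nth h 0 = 1"
    by (simp add: h_def \<sigma>0)
  have \<sigma>_inv: "fps_compose \<sigma> (- \<phi>) * \<sigma> = 1"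
  proof -
    \<comment> \<open>The product squares to 1 and has constant term 1, so uniqueness of the square
      root rules out -1.\<close>
    have "(fps_compose \<sigma> (- \<phi>) * \<sigma>) ^ 2 = fps_compose (\<sigma> * \<sigma>) (- \<phi>) * (\<sigma> * \<sigma>)"
      using \<phi>0 by (simp add: fps_compose_mult_distrib power2_eq_square mult_ac)
    also have "\<dots> = 1"
      unfolding \<sigma>2 \<phi>_def by (rule pseudo_involution_compose[OF assms(3)])
    finally have "fps_sqrt 1 = fps_compose \<sigma> (- \<phi>) * \<sigma>"
      by (intro fps_sqrt_eqI) (simp_all add: \<sigma>0)
    moreover have "fps_sqrt 1 = (1 :: 'a fps)"
      by (intro fps_sqrt_eqI) simp_all
    ultimately show ?thesis
      by simp
  qed
  \<comment> \<open>Here one factor \<sigma> of \<phi> = x \<sigma> \<sigma> is paired with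
    \<sigma>(-\<phi>), its reciprocal.\<close>
  have "fps_compose u (- \<phi>) = - (fps_X * \<sigma> * (fps_compose \<sigma> (- \<phi>) * \<sigma>))"
    using \<phi>0 by (simp add: u_def fps_compose_mult_distrib \<phi>_def mult_ac flip: \<sigma>2)
  then have u_odd: "fps_compose u (- \<phi>) = - u"
    by (simp add: \<sigma>_inv u_def)
  \<comment> \<open>The relation h(-x) h(x) = 1 is checked after substituting \<open>u\<close>,
    where \<open>h\<close> becomes the known series \<sigma>; \<open>u\<close> is then
    cancelled.\<close>
  have "fps_compose (fps_compose h (- fps_X) * h) u = fps_compose h (- u) * \<sigma>"
    using u0 hu
    by (simp add: fps_compose_mult_distrib fps_compose_uminus flip: fps_compose_assoc)
  \<comment> \<open>Since -u = u(-\<phi>), the left side is h(u) evaluated at -\<phi>.\<close>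
  also have "fps_compose h (- u) = fps_compose \<sigma> (- \<phi>)"
    unfolding hu[symmetric] using u0 \<phi>0 by (simp add: u_odd flip: fps_compose_assoc)
  also have "fps_compose \<sigma> (- \<phi>) * \<sigma> = fps_compose 1 u"
    by (simp add: \<sigma>_inv)
  finally have "fps_compose h (- fps_X) * h = 1"
    by (rule fps_compose_right_cancel[OF u0 u1])
  then have sym: "fps_compose h (- fps_X) = inverse h"
    by (metis fps_inverse_unique mult.commute)
  have "riordan 1 u \<odot> riordan 1 (fps_X * h) = riordan 1 (fps_X * g)"
    using u0 hu \<sigma>2 by (simp add: riordan_mult fps_compose_mult_distrib u_def mult.assoc)
  moreover obtain s where "h = s + fps_sqrt (s ^ 2 + 1)" "\<And>n. fps_nth s (2 * n) = 0"
    using fps_reciprocal_symmetric_representation[OF h0 sym] by blast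
  ultimately show ?thesis
    using sym unfolding u_def \<sigma>_def by metis
qed

end
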